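(* Let $T$ be an automorphism of a standard Lebesgue probability space $(X,\mu)$, let $P\subset\mathbb{Z}$ be an infinite set such that the group $H_P(T)$ is ergodic, let $k\ge 1$, and let $(m_i^1)_i,\dots,(m_i^k)_i$ be sequences of elements of $P$ with $m_i^1,\dots,m_i^k\to\infty$ as $i\to\infty$. Suppose that for any measurable sets $B_1,\dots,B_k\subset X$ $$\mu(T^{m_i^1}B_1\cap\dots\cap T^{m_i^k}B_k)\to\mu(B_1)\cdots\mu(B_k)\qquad (i\to\infty).$$ Then for any measurable sets $B,B_1,\dots,B_k\subset X$ $$\mu(B\cap T^{m_i^1}B_1\cap\dots\cap T^{m_i^k}B_k)\to\mu(B)\mu(B_1)\cdots\mu(B_k)\qquad (i\to\infty).$$
   Context: $G$ is the group of all automorphisms of $(X,\mu)$, i.e. invertible bi-measurable $\mu$-preserving transformations, identified when equal $\mu$-a.e.; $I$ is the identity. For an infinite set $P\subset\mathbb{Z}$, $$H_P(T)=\{S\in G:\ T^{-n}ST^{n}\to I,\ n\in P,\ n\to\infty\},$$ where convergence is strong operator convergence of the associated operators on $L_2(X,\mu)$, i.e. $R_n\to I$ means $\mu(R_nA\,\triangle\,A)\to0$ for every measurable $A$, and the limit is taken along $P$ as $|n|\to\infty$. Likewise $m_i^j\to\infty$ means $|m_i^j|\to\infty$. A subgroup $H\subset G$ is ergodic if every measurable $A$ with $\mu(SA\,\triangle\,A)=0$ for all $S\in H$ satisfies $\mu(A)\in\{0,1\}$. *)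

theory Defs
  imports "HOL-Probability.Probability" "HOL-Algebra.Bij"
begin

definition isomorphic_mod0 :: "'a measure \<Rightarrow> 'b measure \<Rightarrow> bool" where
  "isomorphic_mod0 M N \<longleftrightarrow>
     (\<exists>A\<in>null_sets M. \<exists>B\<in>null_sets N. \<exists>f.
        bij_betw f (space M - A) (space N - B) \<and>
        f \<in> measurable (restrict_space M (space M - A)) (restrict_space N (space N - B)) \<and>
        inv_into (space M - A) f
          \<in> measurable (restrict_space N (space N - B)) (restrict_space M (space M - A)) \<and>
        distr (restrict_space M (space M - A)) (restrict_space N (space N - B)) f
          = restrict_space N (space N - B))"

(* Lebesgue space in Rokhlin's sense: a complete probability space that is, modulo null sets,
   a segment with Lebesgue measure together with at most countably many atoms. *)
definition lebesgue_prob_space :: "'a measure \<Rightarrow> bool" where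
  "lebesgue_prob_space M \<longleftrightarrow>
     prob_space M \<and> complete_measure M \<and>
     (\<exists>A. countable A \<and> A \<subseteq> space M \<and> (\<forall>x\<in>A. {x} \<in> sets M \<and> measure M {x} > 0) \<and>
        isomorphic_mod0 (restrict_space M (space M - A))
          (lebesgue_on {0..measure M (space M - A)}))"

(* Automorphisms are everywhere defined representatives: bijections of the space, undefined
   outside of it (see BijGroup). Almost everywhere equal representatives are not identified;
   the notions below are invariant under changing representatives on null sets. *)
definition aut_group :: "'a measure \<Rightarrow> ('a \<Rightarrow> 'a) monoid" where
  "aut_group M = (BijGroup (space M))
     \<lparr>carrier := {f \<in> Bij (space M).
        f \<in> measurable M M \<and> inv_into (space M) f \<in> measurable M M \<and> distr M M f = M}\<rparr>"

definition converges_to_id :: "'a measure \<Rightarrow> ('b \<Rightarrow> 'a \<Rightarrow> 'a) \<Rightarrow> 'b filter \<Rightarrow> bool" where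
  "converges_to_id M R F \<longleftrightarrow>
     (\<forall>A\<in>sets M. ((\<lambda>n. measure M (sym_diff (R n ` A) A)) \<longlongrightarrow> 0) F)"

(* The filter expresses that the absolute value of n tends to infinity with n ranging over P. *)
definition H_group :: "'a measure \<Rightarrow> int set \<Rightarrow> ('a \<Rightarrow> 'a) \<Rightarrow> ('a \<Rightarrow> 'a) set" where
  "H_group M P T = {S \<in> carrier (aut_group M).
     converges_to_id M
       (\<lambda>n. T [^]\<^bsub>aut_group M\<^esub> (- n) \<otimes>\<^bsub>aut_group M\<^esub> S \<otimes>\<^bsub>aut_group M\<^esub> T [^]\<^bsub>aut_group M\<^esub> n)
       (inf (filtercomap abs at_top) (principal P))}"

definition ergodic_group :: "'a measure \<Rightarrow> ('a \<Rightarrow> 'a) set \<Rightarrow> bool" where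
  "ergodic_group M H \<longleftrightarrow>
     (\<forall>A\<in>sets M. (\<forall>S\<in>H. measure M (sym_diff (S ` A) A) = 0) \<longrightarrow> measure M A \<in> {0, 1})"

lemma group_aut_group: "group (aut_group M)"
proof -
  let ?S = "space M"
  let ?C = "{f \<in> Bij ?S. f \<in> measurable M M \<and> inv_into ?S f \<in> measurable M M \<and> distr M M f = M}"
  interpret B: group "BijGroup ?S" by (rule group_BijGroup)
  have "subgroup ?C (BijGroup ?S)"
  proof (rule B.subgroupI)
    show "?C \<subseteq> carrier (BijGroup ?S)" by (auto simp: BijGroup_def)
    have id: "(\<lambda>x\<in>?S. x) \<in> measurable M M" by (subst measurable_cong[of _ _ "\<lambda>x. x"]) auto
    have "inv_into ?S (\<lambda>x\<in>?S. x) \<in> measurable M M \<longleftrightarrow> (\<lambda>x. x) \<in> measurable M M"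
      by (rule measurable_cong) (rule inv_into_f_eq, auto simp: inj_on_def)
    moreover have "distr M M (\<lambda>x\<in>?S. x) = distr M M (\<lambda>x. x)" by (rule distr_cong) auto
    ultimately have "(\<lambda>x\<in>?S. x) \<in> ?C" using id by (auto simp: id_Bij)
    then show "?C \<noteq> {}" by blast
  next
    fix f assume "f \<in> ?C"
    then have f: "f \<in> Bij ?S" "f \<in> measurable M M" "inv_into ?S f \<in> measurable M M"
      "distr M M f = M" by auto
    then have bij: "bij_betw f ?S ?S" by (auto simp: Bij_def)
    let ?g = "\<lambda>x\<in>?S. inv_into ?S f x"
    have gB: "?g \<in> Bij ?S" using f(1) by (rule restrict_inv_into_Bij)
    have gm: "?g \<in> measurable M M"
      using f(3) by (subst measurable_cong[of _ _ "inv_into ?S f"]) auto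
    have "inv_into ?S ?g x = f x" if "x \<in> ?S" for x
    proof (rule inv_into_f_eq)
      show "inj_on ?g ?S" using gB by (auto simp: Bij_def bij_betw_def)
      show "f x \<in> ?S" using bij that by (auto simp: bij_betw_def)
      then show "?g (f x) = x" using bij that by (simp add: bij_betw_inv_into_left)
    qed
    then have gi: "inv_into ?S ?g \<in> measurable M M"
      using f(2) by (subst measurable_cong[of _ _ f]) auto
    have "distr M M ?g = distr (distr M M f) M ?g" by (simp add: f(4))
    also have "\<dots> = distr M M (?g \<circ> f)" using gm f(2) by (rule distr_distr)
    also have "\<dots> = distr M M (\<lambda>x. x)"
      using bij by (intro distr_cong) (auto simp: bij_betw_inv_into_left bij_betwE)
    finally have "distr M M ?g = M" by simp
    then show "inv\<^bsub>BijGroup ?S\<^esub> f \<in> ?C" using gB gm gi f(1) by (simp add: inv_BijGroup)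
  next
    fix f g assume "f \<in> ?C" "g \<in> ?C"
    then have f: "f \<in> Bij ?S" "f \<in> measurable M M" "inv_into ?S f \<in> measurable M M"
      "distr M M f = M" and g: "g \<in> Bij ?S" "g \<in> measurable M M" "inv_into ?S g \<in> measurable M M"
      "distr M M g = M" by auto
    then have bf: "bij_betw f ?S ?S" and bg: "bij_betw g ?S ?S" by (auto simp: Bij_def)
    let ?h = "compose ?S f g"
    have hB: "?h \<in> Bij ?S" using f g by (simp add: compose_Bij)
    have hm: "?h \<in> measurable M M"
      using measurable_comp[OF g(2) f(2)]
      by (subst measurable_cong[of _ _ "f \<circ> g"]) (auto simp: compose_def)
    have "inv_into ?S ?h x = (inv_into ?S g \<circ> inv_into ?S f) x" if "x \<in> ?S" for x
    proof (rule inv_into_f_eq)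
      have 1: "inv_into ?S f x \<in> ?S" using f(1) that by (rule Bij_inv_into_mem)
      have 2: "inv_into ?S g (inv_into ?S f x) \<in> ?S" using g(1) 1 by (rule Bij_inv_into_mem)
      show "inj_on ?h ?S" using hB by (auto simp: Bij_def bij_betw_def)
      show "(inv_into ?S g \<circ> inv_into ?S f) x \<in> ?S" using 2 by simp
      show "?h ((inv_into ?S g \<circ> inv_into ?S f) x) = x"
        using 1 2 that bf bg by (simp add: compose_def bij_betw_inv_into_right)
    qed
    then have hi: "inv_into ?S ?h \<in> measurable M M"
      using measurable_comp[OF f(3) g(3)]
      by (subst measurable_cong[of _ _ "inv_into ?S g \<circ> inv_into ?S f"]) auto
    have "distr M M ?h = distr M M (f \<circ> g)" by (rule distr_cong) (auto simp: compose_def)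
    also have "\<dots> = distr (distr M M g) M f" using f(2) g(2) by (simp add: distr_distr)
    finally have "distr M M ?h = M" using f(4) g(4) by simp
    then show "f \<otimes>\<^bsub>BijGroup ?S\<^esub> g \<in> ?C" using hB hm hi f(1) g(1) by (simp add: BijGroup_def)
  qed
  then have "group (BijGroup ?S\<lparr>carrier := ?C\<rparr>)"
    using B.is_group by (rule subgroup.subgroup_is_group)
  then show ?thesis by (simp add: aut_group_def)
qed

end

theory Submission
  imports Defs
begin

text \<open>
  Write \<open>E i\<close> for the intersection of the sets \<open>T\<^sup>m B j\<close> with \<open>m = m j i\<close>. For \<open>S\<close> in the group
  \<open>H_group M P T\<close> one has \<open>S T\<^sup>m = T\<^sup>m R\<close> with the conjugate \<open>R = T\<^sup>-\<^sup>m S T\<^sup>m\<close>, and \<open>R\<close> is close to the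
  identity when \<open>\<bar>m\<bar>\<close> is large. So \<open>S\<close> moves each of the \<open>k\<close> translates by little, and hence
  also their intersection: the measure of the symmetric difference of \<open>S (E i)\<close> and \<open>E i\<close> tends
  to 0. This reduces the theorem to a statement without \<open>T\<close>
  (lemma \<open>asymptotically_invariant_sets_equidistribute\<close>): if sets \<open>E i\<close> are asymptotically
  invariant under each element of an ergodic group and their measures converge to \<open>c\<close>, then the
  measure of \<open>A \<inter> E i\<close> converges to \<open>c\<close> times that of \<open>A\<close>.

  In the language of \<open>L\<^sub>2\<close>, every weak limit of the indicator functions of the \<open>E i\<close> is an
  invariant function, hence constant by ergodicity, hence equal to \<open>c\<close>. The weak limits are
  obtained here from set functions: the functions \<open>A \<mapsto> measure M (A \<inter> E i)\<close> take values in the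
  unit interval, so they have pointwise cluster points by Tychonoff's theorem, and each of these
  is dominated by \<open>M\<close>, hence is a countably additive measure with a Radon-Nikodym density \<open>h\<close>.
  Asymptotic invariance of the \<open>E i\<close> makes the limit measure, and therefore \<open>h\<close>, invariant. Since
  all cluster points agree, the sequence itself converges.
\<close>

section \<open>Cluster points of bounded set functions\<close>

text \<open>
  Tychonoff's theorem for a power of the unit interval. The index set of the functions is
  filtered arbitrarily and the limit is taken along a finer filter; a convergent subsequence
  need not exist when the set of arguments is uncountable.
\<close>

lemma cluster_point_of_bounded_functions:
  fixes \<Phi> :: "'i \<Rightarrow> 'b \<Rightarrow> real"
  assumes "F \<noteq> bot" and bounded: "\<And>i x. \<Phi> i x \<in> {0..1}"
  obtains G \<nu> where "G \<noteq> bot" "G \<le> F" "\<And>x. ((\<lambda>i. \<Phi> i x) \<longlongrightarrow> \<nu> x) G"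
proof -
  let ?K = "PiE UNIV (\<lambda>_::'b. {0..1::real})"
  have "compactin (product_topology (\<lambda>_. euclidean) UNIV) ?K"
    by (simp add: compactin_PiE)
  then have "compact ?K"
    by (simp add: euclidean_product_topology)
  moreover have "filtermap \<Phi> F \<noteq> bot" "eventually (\<lambda>f. f \<in> ?K) (filtermap \<Phi> F)"
    using assms by (simp_all add: filtermap_bot_iff eventually_filtermap PiE_UNIV_domain)
  ultimately obtain \<nu> where \<nu>: "inf (nhds \<nu>) (filtermap \<Phi> F) \<noteq> bot"
    unfolding compact_filter by blast
  define G where "G = inf F (filtercomap \<Phi> (nhds \<nu>))"
  have "G \<noteq> bot"
  proof
    assume "G = bot"
    then have "eventually (\<lambda>_. False) G" by simp
    then obtain Q R where QR: "eventually Q F" "eventually R (nhds \<nu>)" "\<And>i. Q i \<Longrightarrow> \<not> R (\<Phi> i)"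
      unfolding G_def eventually_inf eventually_filtercomap by blast
    then have "eventually (\<lambda>f. \<not> R f) (filtermap \<Phi> F)"
      by (auto simp: eventually_filtermap elim: eventually_mono)
    with QR(2) have "eventually (\<lambda>_. False) (inf (nhds \<nu>) (filtermap \<Phi> F))"
      unfolding eventually_inf by blast
    with \<nu> show False by (simp add: trivial_limit_def)
  qed
  moreover have "G \<le> F" by (simp add: G_def)
  moreover have "((\<lambda>i. \<Phi> i x) \<longlongrightarrow> \<nu> x) G" for x
  proof -
    have "filterlim \<Phi> (nhds \<nu>) G"
      unfolding filterlim_def G_def filtermap_le_iff_le_filtercomap by simp
    moreover have "filterlim (\<lambda>f. f x) (nhds (\<nu> x)) (nhds \<nu>)"
    proof -
      have "continuous_on UNIV (\<lambda>f :: 'b \<Rightarrow> real. f x)" by simp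
      then have "((\<lambda>f. f x) \<longlongrightarrow> \<nu> x) (at \<nu>)" by (simp add: continuous_on_def)
      then show ?thesis
        using tendsto_at_iff_tendsto_nhds[of "\<lambda>f. f x" \<nu>] by simp
    qed
    ultimately show ?thesis by (rule filterlim_compose[rotated])
  qed
  ultimately show ?thesis by (rule that)
qed

text \<open>
  Convergence at a single argument \<open>y\<close> may be tested on filters along which all arguments
  converge simultaneously: if it failed, the values at \<open>y\<close> would stay away from \<open>l\<close> along some
  finer filter, which could be refined further by compactness.
\<close>

lemma tendsto_if_cluster_points_eq:
  fixes \<Phi> :: "'i \<Rightarrow> 'b \<Rightarrow> real"
  assumes bounded: "\<And>i x. \<Phi> i x \<in> {0..1}"
    and unique: "\<And>G \<nu>. G \<noteq> bot \<Longrightarrow> G \<le> F \<Longrightarrow> (\<And>x. ((\<lambda>i. \<Phi> i x) \<longlongrightarrow> \<nu> x) G) \<Longrightarrow> \<nu> y = l"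
  shows "((\<lambda>i. \<Phi> i y) \<longlongrightarrow> l) F"
proof (rule topological_tendstoI, rule ccontr)
  fix U assume U: "open U" "l \<in> U" and "\<not> eventually (\<lambda>i. \<Phi> i y \<in> U) F"
  then have "inf F (principal {i. \<Phi> i y \<notin> U}) \<noteq> bot"
    by (simp add: trivial_limit_def eventually_inf_principal)
  then obtain G \<nu> where G: "G \<noteq> bot" "G \<le> inf F (principal {i. \<Phi> i y \<notin> U})"
    and lim: "\<And>x. ((\<lambda>i. \<Phi> i x) \<longlongrightarrow> \<nu> x) G"
    by (rule cluster_point_of_bounded_functions[where \<Phi> = \<Phi>, OF _ bounded]) blast
  have "\<nu> y = l" using unique[OF G(1) _ lim] G(2) by simp
  with lim U have "eventually (\<lambda>i. \<Phi> i y \<in> U) G" by (metis topological_tendstoD)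
  moreover have "eventually (\<lambda>i. \<Phi> i y \<notin> U) G"
    using G(2) by (auto simp: le_filter_def eventually_inf_principal)
  ultimately have "eventually (\<lambda>_. False) G" by eventually_elim simp
  with G(1) show False by simp
qed

section \<open>Densities of limits of traces\<close>

text \<open>
  Finite additivity survives the pointwise limit. Countable additivity does too, because
  \<open>\<nu> \<le> measure M\<close> forces continuity at the empty set; the same bound gives absolute continuity.
\<close>

lemma (in prob_space) limit_of_traces_has_density:
  assumes "G \<noteq> bot" and E: "\<And>i. E i \<in> sets M"
    and lim: "\<And>A. A \<in> sets M \<Longrightarrow> ((\<lambda>i. measure M (A \<inter> E i)) \<longlongrightarrow> \<nu> A) G"
  obtains h :: "'a \<Rightarrow> ennreal" where "h \<in> borel_measurable M"
    "\<And>A. A \<in> sets M \<Longrightarrow> emeasure (density M h) A = ennreal (\<nu> A)"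
proof -
  have nonneg: "0 \<le> \<nu> A" if "A \<in> sets M" for A
    using tendsto_lowerbound[OF lim[OF that]] assms(1) by simp
  have le: "\<nu> A \<le> measure M A" if "A \<in> sets M" for A
  proof (rule tendsto_upperbound[OF lim[OF that]])
    show "\<forall>\<^sub>F i in G. measure M (A \<inter> E i) \<le> measure M A"
      using that by (auto intro!: finite_measure_mono always_eventually)
  qed fact
  have add: "\<nu> (A \<union> B) = \<nu> A + \<nu> B"
    if "A \<in> sets M" "B \<in> sets M" "A \<inter> B = {}" for A B
  proof (rule tendsto_unique[OF assms(1) lim])
    have "measure M ((A \<union> B) \<inter> E i) = measure M (A \<inter> E i) + measure M (B \<inter> E i)" for i
      using that E by (subst finite_measure_Union[symmetric]) (auto simp: Int_Un_distrib2)
    then show "((\<lambda>i. measure M ((A \<union> B) \<inter> E i)) \<longlongrightarrow> \<nu> A + \<nu> B) G"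
      using tendsto_add[OF lim lim] that by simp
  qed (use that in auto)
  let ?N = "\<lambda>A. ennreal (\<nu> A)"
  have empty: "\<nu> {} = 0" using le[of "{}"] nonneg[of "{}"] by simp
  have pos: "positive (sets M) ?N" by (simp add: positive_def empty)
  moreover have "countably_additive (sets M) ?N"
  proof (rule sets.empty_continuous_imp_countably_additive[OF pos])
    show "additive (sets M) ?N"
      using add nonneg by (auto simp: additive_def ennreal_plus)
    show "\<forall>A\<in>sets M. ?N A \<noteq> \<infinity>" by simp
    fix A :: "nat \<Rightarrow> 'a set"
    assume A: "range A \<subseteq> sets M" "decseq A" "(\<Inter>i. A i) = {}"
    then have "(\<lambda>n. measure M (A n)) \<longlonglongrightarrow> 0"
      using finite_Lim_measure_decseq[of A] by simp
    then have "(\<lambda>n. \<nu> (A n)) \<longlonglongrightarrow> 0"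
      by (rule tendsto_sandwich[OF _ _ tendsto_const, rotated 2])
         (use A le nonneg in \<open>auto intro!: always_eventually\<close>)
    then show "(\<lambda>n. ?N (A n)) \<longlonglongrightarrow> 0"
      by (metis ennreal_0 tendsto_ennrealI)
  qed
  ultimately have N: "emeasure (measure_of (space M) (sets M) ?N) A = ?N A" if "A \<in> sets M" for A
    using that by (simp add: emeasure_measure_of_sigma sets.sigma_algebra_axioms)
  have "absolutely_continuous M (measure_of (space M) (sets M) ?N)"
  proof -
    have "?N A = 0" if "A \<in> null_sets M" for A
      using le[of A] that by (auto simp: measure_def ennreal_eq_0_iff null_sets_def)
    then show ?thesis
      using N by (auto simp: absolutely_continuous_def null_sets_def)
  qed
  then obtain h where "h \<in> borel_measurable M"
    "density M h = measure_of (space M) (sets M) ?N"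
    using Radon_Nikodym[of "measure_of (space M) (sets M) ?N"] by auto
  with N show ?thesis by (intro that[of h]) auto
qed

section \<open>Automorphisms acting on measurable sets\<close>

lemma aut_groupD:
  assumes "f \<in> carrier (aut_group M)"
  shows "f \<in> measurable M M" "distr M M f = M" "bij_betw f (space M) (space M)"
    "inv_into (space M) f \<in> measurable M M"
  using assms by (auto simp: aut_group_def Bij_def)

lemma sets_aut_image:
  assumes f: "f \<in> carrier (aut_group M)" and A: "A \<in> sets M"
  shows "f ` A \<in> sets M"
proof -
  have "f ` A = inv_into (space M) f -` A \<inter> space M"
    using aut_groupD(3)[OF f] sets.sets_into_space[OF A]
    by (fastforce simp: bij_betw_def inv_into_f_f f_inv_into_f intro!: image_eqI[rotated])
  then show ?thesis
    using measurable_sets[OF aut_groupD(4)[OF f] A] by simp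
qed

lemma vimage_aut_image:
  assumes f: "f \<in> carrier (aut_group M)" and A: "A \<in> sets M"
  shows "f -` (f ` A) \<inter> space M = A"
proof -
  have "inj_on f (space M)" using aut_groupD(3)[OF f] by (simp add: bij_betw_def)
  then show ?thesis
    using sets.sets_into_space[OF A] by (auto dest: inj_onD)
qed

lemma measure_aut_image:
  assumes f: "f \<in> carrier (aut_group M)" and A: "A \<in> sets M"
  shows "measure M (f ` A) = measure M A"
proof -
  have "measure M (f ` A) = measure (distr M M f) (f ` A)" by (simp add: aut_groupD(2)[OF f])
  also have "\<dots> = measure M A"
    using aut_groupD(1)[OF f] sets_aut_image[OF f A]
    by (simp add: measure_distr vimage_aut_image[OF f A])
  finally show ?thesis .
qed

lemma aut_image_sym_diff:
  assumes f: "f \<in> carrier (aut_group M)" and "A \<in> sets M" "B \<in> sets M"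
  shows "f ` sym_diff A B = sym_diff (f ` A) (f ` B)"
proof -
  have "inj_on f (A \<union> B)"
    using aut_groupD(3)[OF f] assms(2,3)[THEN sets.sets_into_space]
    by (auto simp: bij_betw_def intro: inj_on_subset)
  then show ?thesis by (auto simp: inj_on_def)
qed

lemma aut_mult_image:
  assumes "f \<in> carrier (aut_group M)" "g \<in> carrier (aut_group M)" "A \<in> sets M"
  shows "(f \<otimes>\<^bsub>aut_group M\<^esub> g) ` A = f ` g ` A"
proof -
  have "f \<otimes>\<^bsub>aut_group M\<^esub> g = compose (space M) f g"
    using assms by (auto simp: aut_group_def BijGroup_def)
  then show ?thesis
    using sets.sets_into_space[OF assms(3)] by (force simp: compose_def image_image)
qed

section \<open>Asymptotically invariant sets under an ergodic group\<close>

text \<open>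
  Both \<open>h \<circ> S\<close> and \<open>h\<close> are densities of the same finite measure: the change of variables
  \<open>y = S x\<close> turns the integral of \<open>h \<circ> S\<close> over \<open>A\<close> into that of \<open>h\<close> over \<open>S ` A\<close>.
\<close>

lemma (in prob_space) invariant_density:
  assumes S: "S \<in> carrier (aut_group M)" and h: "h \<in> borel_measurable M"
    and fin: "emeasure (density M h) (space M) \<noteq> \<infinity>"
    and inv: "\<And>A. A \<in> sets M \<Longrightarrow> emeasure (density M h) (S ` A) = emeasure (density M h) A"
  shows "AE x in M. h (S x) = h x"
proof -
  note [measurable] = h aut_groupD(1)[OF S]
  have "density M (\<lambda>x. h (S x)) = density M h"
  proof (rule measure_eqI)
    fix A assume "A \<in> sets (density M (\<lambda>x. h (S x)))"
    then have A: "A \<in> sets M" by simp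
    note SA [measurable] = sets_aut_image[OF S A]
    have ind: "indicator A x = indicator (S ` A) (S x)" if "x \<in> space M" for x
      using vimage_aut_image[OF S A] that by (auto simp: indicator_def)
    have "emeasure (density M (\<lambda>x. h (S x))) A = (\<integral>\<^sup>+x. h (S x) * indicator A x \<partial>M)"
      using A by (simp add: emeasure_density)
    also have "\<dots> = (\<integral>\<^sup>+x. h (S x) * indicator (S ` A) (S x) \<partial>M)"
      by (intro nn_integral_cong) (simp add: ind)
    also have "\<dots> = (\<integral>\<^sup>+y. h y * indicator (S ` A) y \<partial>distr M M S)"
      by (simp add: nn_integral_distr)
    also have "\<dots> = emeasure (density M h) (S ` A)"
      by (simp add: aut_groupD(2)[OF S] emeasure_density)
    also have "\<dots> = emeasure (density M h) A" by (rule inv[OF A])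
    finally show "emeasure (density M (\<lambda>x. h (S x))) A = emeasure (density M h) A" .
  qed simp
  then show ?thesis
    by (subst (asm) density_unique_iff) auto
qed

text \<open>
  Invariance almost everywhere is a statement on the preimage of \<open>A\<close>, whereas ergodicity is
  phrased by images; applying the measure preserving \<open>S\<close> translates one into the other.
\<close>

lemma null_sym_diff_if_AE_invariant:
  assumes S: "S \<in> carrier (aut_group M)" and A: "A \<in> sets M"
    and ae: "AE x in M. S x \<in> A \<longleftrightarrow> x \<in> A"
  shows "measure M (sym_diff (S ` A) A) = 0"
proof -
  let ?B = "S -` A \<inter> space M"
  have B: "?B \<in> sets M" using aut_groupD(1)[OF S] A by (rule measurable_sets)
  have "S ` ?B = A"
    using aut_groupD(3)[OF S] sets.sets_into_space[OF A] by (force simp: bij_betw_def)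
  then have "sym_diff (S ` A) A = S ` sym_diff A ?B"
    by (simp add: aut_image_sym_diff[OF S A B])
  then have "measure M (sym_diff (S ` A) A) = measure M (sym_diff A ?B)"
    using A B by (simp add: measure_aut_image[OF S])
  also have "\<dots> = measure M {}"
    using ae A B by (intro measure_eq_AE) auto
  finally show ?thesis by simp
qed

text \<open>
  The sets \<open>{h > c}\<close> and \<open>{h < c}\<close> are invariant, so each has measure 0 or 1. Measure 1 is
  impossible for either of them, because the mean of \<open>h\<close> is \<open>c\<close>.
\<close>

lemma (in prob_space) constant_density:
  assumes H: "H \<subseteq> carrier (aut_group M)" and erg: "ergodic_group M H"
    and h [measurable]: "h \<in> borel_measurable M"
    and inv: "\<And>S. S \<in> H \<Longrightarrow> AE x in M. h (S x) = h x"
    and int: "(\<integral>\<^sup>+x. h x \<partial>M) = ennreal c"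
  shows "AE x in M. h x = ennreal c"
proof -
  have dichotomy: "(AE x in M. h x \<in> U) \<or> (AE x in M. h x \<notin> U)"
    if [measurable]: "U \<in> sets borel" for U
  proof -
    let ?A = "{x \<in> space M. h x \<in> U}"
    have A: "?A \<in> sets M" by measurable
    have "measure M (sym_diff (S ` ?A) ?A) = 0" if "S \<in> H" for S
    proof (rule null_sym_diff_if_AE_invariant[OF _ A])
      show S: "S \<in> carrier (aut_group M)" using H that by blast
      show "AE x in M. S x \<in> ?A \<longleftrightarrow> x \<in> ?A"
        using inv[OF that] AE_space
        by eventually_elim (use measurable_space[OF aut_groupD(1)[OF S]] in auto)
    qed
    with erg A have "measure M ?A \<in> {0, 1}" unfolding ergodic_group_def by blast
    then show ?thesis
      using prob_eq_0[of ?A] prob_eq_1[of ?A] A by auto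
  qed
  have "AE x in M. \<not> c < h x"
  proof (rule ccontr)
    assume "\<not> (AE x in M. \<not> c < h x)"
    then have gt: "AE x in M. c < h x" using dichotomy[of "{c<..}"] by auto
    have "(\<integral>\<^sup>+x. c \<partial>M) < (\<integral>\<^sup>+x. h x \<partial>M)"
    proof (rule nn_integral_less)
      show "AE x in M. c \<le> h x" using gt by eventually_elim simp
      show "\<not> (AE x in M. h x \<le> c)"
      proof
        assume "AE x in M. h x \<le> c"
        with gt have "AE x in M. False" by eventually_elim (simp add: not_less[symmetric])
        then show False by simp
      qed
    qed (auto simp: emeasure_space_1)
    then show False by (simp add: int emeasure_space_1)
  qed
  moreover have "AE x in M. \<not> h x < c"
  proof (rule ccontr)
    assume "\<not> (AE x in M. \<not> h x < c)"
    then have lt: "AE x in M. h x < c" using dichotomy[of "{..<c}"] by auto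
    have "(\<integral>\<^sup>+x. h x \<partial>M) < (\<integral>\<^sup>+x. c \<partial>M)"
    proof (rule nn_integral_less)
      show "AE x in M. h x \<le> c" using lt by eventually_elim simp
      show "\<not> (AE x in M. c \<le> h x)"
      proof
        assume "AE x in M. c \<le> h x"
        with lt have "AE x in M. False" by eventually_elim (simp add: not_less[symmetric])
        then show False by simp
      qed
    qed (auto simp: int)
    then show False by (simp add: int emeasure_space_1)
  qed
  ultimately show ?thesis by eventually_elim (simp add: not_less)
qed

text \<open>
  Let \<open>\<nu>\<close> be a cluster point of the traces on the \<open>E i\<close>. As \<open>S\<close> preserves the measure, \<open>A \<inter> E i\<close> is
  as large as \<open>S A \<inter> S (E i)\<close>, which differs little from \<open>S A \<inter> E i\<close>. In the limit
  \<open>\<nu> (S A) = \<nu> A\<close>, so the density of \<open>\<nu>\<close> is invariant and thus the constant \<open>c\<close>.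
\<close>

lemma (in prob_space) asymptotically_invariant_sets_equidistribute:
  assumes H: "H \<subseteq> carrier (aut_group M)" and erg: "ergodic_group M H"
    and E: "\<And>i. E i \<in> sets M"
    and asymp: "\<And>S. S \<in> H \<Longrightarrow> ((\<lambda>i. measure M (sym_diff (S ` E i) (E i))) \<longlongrightarrow> 0) F"
    and c: "((\<lambda>i. measure M (E i)) \<longlongrightarrow> c) F"
    and B: "B \<in> sets M"
  shows "((\<lambda>i. measure M (B \<inter> E i)) \<longlongrightarrow> measure M B * c) F"
proof (rule tendsto_if_cluster_points_eq[where \<Phi> = "\<lambda>i A. measure M (A \<inter> E i)" and y = B])
  show "measure M (A \<inter> E i) \<in> {0..1}" for i A by simp
  fix G \<nu>
  assume G: "G \<noteq> bot" "G \<le> F" and lim: "\<And>A. ((\<lambda>i. measure M (A \<inter> E i)) \<longlongrightarrow> \<nu> A) G"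
  obtain h where h [measurable]: "h \<in> borel_measurable M"
    and N: "\<And>A. A \<in> sets M \<Longrightarrow> emeasure (density M h) A = ennreal (\<nu> A)"
    using limit_of_traces_has_density[OF G(1) E lim] by blast
  have c_G: "((\<lambda>i. measure M (E i)) \<longlongrightarrow> c) G" using c G(2) by (rule tendsto_mono[rotated])
  have c_nonneg: "0 \<le> c" by (rule tendsto_lowerbound[OF c_G]) (use G in auto)
  have "\<nu> (space M) = c"
  proof (rule tendsto_unique[OF G(1) lim])
    have "space M \<inter> E i = E i" for i using sets.sets_into_space[OF E] by blast
    then show "((\<lambda>i. measure M (space M \<inter> E i)) \<longlongrightarrow> c) G" using c_G by simp
  qed
  then have total: "emeasure (density M h) (space M) = ennreal c" by (simp add: N)
  have "AE x in M. h (S x) = h x" if S: "S \<in> H" for S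
  proof (rule invariant_density[OF _ h])
    show S': "S \<in> carrier (aut_group M)" using H S by blast
    show "emeasure (density M h) (space M) \<noteq> \<infinity>" by (simp add: total)
    fix A assume A: "A \<in> sets M"
    have bound: "\<bar>measure M (S ` A \<inter> E i) - measure M (A \<inter> E i)\<bar>
        \<le> measure M (sym_diff (S ` E i) (E i))" for i
    proof -
      note meas = sets_aut_image[OF S' A] sets_aut_image[OF S' E] E
      have "inj_on S (space M)" using aut_groupD(3)[OF S'] by (simp add: bij_betw_def)
      then have "S ` (A \<inter> E i) = S ` A \<inter> S ` E i"
        using A E by (intro inj_on_image_Int) (auto dest: sets.sets_into_space)
      then have eq: "measure M (A \<inter> E i) = measure M (S ` A \<inter> S ` E i)"
        using A E measure_aut_image[OF S', of "A \<inter> E i"] by simp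
      have "measure M (S ` A \<inter> E i) \<le> measure M ((S ` A \<inter> S ` E i) \<union> sym_diff (S ` E i) (E i))"
        using meas by (intro finite_measure_mono) auto
      also have "\<dots> \<le> measure M (S ` A \<inter> S ` E i) + measure M (sym_diff (S ` E i) (E i))"
        using meas by (intro measure_Un_le) auto
      finally have 1: "measure M (S ` A \<inter> E i)
          \<le> measure M (S ` A \<inter> S ` E i) + measure M (sym_diff (S ` E i) (E i))" .
      have "measure M (S ` A \<inter> S ` E i) \<le> measure M ((S ` A \<inter> E i) \<union> sym_diff (S ` E i) (E i))"
        using meas by (intro finite_measure_mono) auto
      also have "\<dots> \<le> measure M (S ` A \<inter> E i) + measure M (sym_diff (S ` E i) (E i))"
        using meas by (intro measure_Un_le) auto
      finally show ?thesis using 1 eq by linarith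
    qed
    have "((\<lambda>i. measure M (S ` A \<inter> E i) - measure M (A \<inter> E i)) \<longlongrightarrow> 0) G"
      by (rule Lim_null_comparison[OF _ tendsto_mono[OF G(2) asymp[OF S]]])
         (use bound in \<open>auto intro!: always_eventually\<close>)
    from tendsto_add[OF this lim[of A]] have "\<nu> (S ` A) = \<nu> A"
      using tendsto_unique[OF G(1) lim[of "S ` A"]] by simp
    then show "emeasure (density M h) (S ` A) = emeasure (density M h) A"
      using A sets_aut_image[OF S' A] by (simp add: N)
  qed
  moreover have "(\<integral>\<^sup>+x. h x \<partial>M) = ennreal c"
  proof -
    have "(\<integral>\<^sup>+x. h x \<partial>M) = (\<integral>\<^sup>+x. h x * indicator (space M) x \<partial>M)"
      by (intro nn_integral_cong) simp
    then show ?thesis using total by (simp add: emeasure_density)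
  qed
  ultimately have "AE x in M. h x = ennreal c"
    by (rule constant_density[OF H erg h])
  then have "density M h = density M (\<lambda>_. ennreal c)"
    by (intro density_cong) auto
  then have "ennreal (\<nu> B) = ennreal c * emeasure M B"
    using N[OF B] B by (simp add: emeasure_density_const)
  also have "\<dots> = ennreal (measure M B * c)"
    using c_nonneg by (simp add: emeasure_eq_measure ennreal_mult mult.commute)
  finally show "\<nu> B = measure M B * c"
    using c_nonneg tendsto_lowerbound[OF lim[of B]] G(1) by simp
qed

section \<open>Intersections of translates\<close>

text \<open>
  With \<open>U = T\<^sup>n\<close> one has \<open>S U = U (R n)\<close>, and \<open>U\<close> preserves the measure. This is where conjugates
  by powers of \<open>T\<close>, hence the definition of \<open>H_group\<close>, enter.
\<close>

lemma conjugated_translate: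
  assumes T: "T \<in> carrier (aut_group M)" and S: "S \<in> carrier (aut_group M)" and B: "B \<in> sets M"
  defines "R n \<equiv> T [^]\<^bsub>aut_group M\<^esub> (- n) \<otimes>\<^bsub>aut_group M\<^esub> S \<otimes>\<^bsub>aut_group M\<^esub> T [^]\<^bsub>aut_group M\<^esub> (n::int)"
  shows "measure M (sym_diff (S ` (T [^]\<^bsub>aut_group M\<^esub> n) ` B) ((T [^]\<^bsub>aut_group M\<^esub> n) ` B))
    = measure M (sym_diff (R n ` B) B)"
proof -
  interpret A: group "aut_group M" by (rule group_aut_group)
  let ?U = "T [^]\<^bsub>aut_group M\<^esub> n"
  have U: "?U \<in> carrier (aut_group M)" using T by simp
  have R: "R n \<in> carrier (aut_group M)" using T S by (simp add: R_def)
  have "?U \<otimes>\<^bsub>aut_group M\<^esub> R n = S \<otimes>\<^bsub>aut_group M\<^esub> ?U"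
    using T S by (simp add: R_def A.int_pow_neg A.m_assoc[symmetric])
  then have "?U ` R n ` B = S ` ?U ` B"
    using aut_mult_image[OF U R B] aut_mult_image[OF S U B] by simp
  then have "sym_diff (S ` ?U ` B) (?U ` B) = ?U ` sym_diff (R n ` B) B"
    using aut_image_sym_diff[OF U sets_aut_image[OF R B] B] by simp
  then show ?thesis
    using measure_aut_image[OF U] sets_aut_image[OF R B] B by simp
qed

lemma (in prob_space) measure_sym_diff_image_INT_le:
  assumes S: "S \<in> carrier (aut_group M)" and J: "finite J" "J \<noteq> {}"
    and C: "\<And>j. j \<in> J \<Longrightarrow> C j \<in> sets M"
  shows "measure M (sym_diff (S ` (\<Inter>j\<in>J. C j)) (\<Inter>j\<in>J. C j))
    \<le> (\<Sum>j\<in>J. measure M (sym_diff (S ` C j) (C j)))"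
proof -
  \<comment> \<open>Images commute with intersections of nonempty families only, as an intersection over the
    empty family is not contained in the set on which \<open>S\<close> is injective.\<close>
  obtain j\<^sub>0 where j\<^sub>0: "j\<^sub>0 \<in> J" using J(2) by blast
  have "inj_on S (space M)" using aut_groupD(3)[OF S] by (simp add: bij_betw_def)
  then have "S ` (\<Inter>j\<in>J. C j) = (\<Inter>j\<in>J. S ` C j)"
    using C[THEN sets.sets_into_space] j\<^sub>0
    by (intro image_INT[where A = J and C = "space M" and j = j\<^sub>0]) auto
  then have "measure M (sym_diff (S ` (\<Inter>j\<in>J. C j)) (\<Inter>j\<in>J. C j))
      \<le> measure M (\<Union>j\<in>J. sym_diff (S ` C j) (C j))"
    using C J sets_aut_image[OF S] by (intro finite_measure_mono) auto
  also have "\<dots> \<le> (\<Sum>j\<in>J. measure M (sym_diff (S ` C j) (C j)))"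
    using C J sets_aut_image[OF S] by (intro finite_measure_subadditive_finite) auto
  finally show ?thesis .
qed

theorem theorem5:
  fixes M :: "'a measure"
    and T :: "'a \<Rightarrow> 'a"
    and P :: "int set"
    and k :: nat
    and m :: "nat \<Rightarrow> nat \<Rightarrow> int"
  assumes "lebesgue_prob_space M"
    and "T \<in> carrier (aut_group M)"
    and "infinite P"
    and "ergodic_group M (H_group M P T)"
    and "k \<ge> 1"
    and "\<And>j i. j \<in> {1..k} \<Longrightarrow> m j i \<in> P"
    and "\<And>j. j \<in> {1..k} \<Longrightarrow> filterlim (\<lambda>i. \<bar>m j i\<bar>) at_top sequentially"
    and "\<And>B. (\<forall>j\<in>{1..k}. B j \<in> sets M) \<Longrightarrow>
      (\<lambda>i. measure M (\<Inter>j\<in>{1..k}. (T [^]\<^bsub>aut_group M\<^esub> m j i) ` B j))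
        \<longlonglongrightarrow> (\<Prod>j\<in>{1..k}. measure M (B j))"
  shows "\<And>B\<^sub>0 B. B\<^sub>0 \<in> sets M \<Longrightarrow> (\<forall>j\<in>{1..k}. B j \<in> sets M) \<Longrightarrow>
      (\<lambda>i. measure M (B\<^sub>0 \<inter> (\<Inter>j\<in>{1..k}. (T [^]\<^bsub>aut_group M\<^esub> m j i) ` B j)))
        \<longlonglongrightarrow> measure M B\<^sub>0 * (\<Prod>j\<in>{1..k}. measure M (B j))"
proof -
  fix B\<^sub>0 B assume B\<^sub>0: "B\<^sub>0 \<in> sets M" and B: "\<forall>j\<in>{1..k}. B j \<in> sets M"
  interpret prob_space M using assms(1) by (simp add: lebesgue_prob_space_def)
  interpret A: group "aut_group M" by (rule group_aut_group)
  let ?C = "\<lambda>i j. (T [^]\<^bsub>aut_group M\<^esub> m j i) ` B j"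
  let ?E = "\<lambda>i. \<Inter>j\<in>{1..k}. ?C i j"
  have C: "?C i j \<in> sets M" if "j \<in> {1..k}" for i j
    using assms(2) B that by (intro sets_aut_image) auto
  show "(\<lambda>i. measure M (B\<^sub>0 \<inter> ?E i)) \<longlonglongrightarrow> measure M B\<^sub>0 * (\<Prod>j\<in>{1..k}. measure M (B j))"
  proof (rule asymptotically_invariant_sets_equidistribute[OF _ assms(4) _ _ assms(8)[OF B] B\<^sub>0])
    show "H_group M P T \<subseteq> carrier (aut_group M)" by (auto simp: H_group_def)
    show "?E i \<in> sets M" for i using C assms(5) by (intro sets.finite_INT) auto
    fix S assume S: "S \<in> H_group M P T"
    then have S': "S \<in> carrier (aut_group M)" by (simp add: H_group_def)
    have "(\<lambda>i. measure M (sym_diff (S ` ?C i j) (?C i j))) \<longlonglongrightarrow> 0" if j: "j \<in> {1..k}" for j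
    proof -
      have "filterlim (m j) (inf (filtercomap abs at_top) (principal P)) sequentially"
        using assms(6,7)[OF j]
        by (auto simp: filterlim_inf filterlim_principal filterlim_filtercomap_iff o_def)
      then show ?thesis
        using S B j
        by (auto simp: H_group_def converges_to_id_def conjugated_translate[OF assms(2) S']
            intro: filterlim_compose)
    qed
    then have "(\<lambda>i. \<Sum>j\<in>{1..k}. measure M (sym_diff (S ` ?C i j) (?C i j))) \<longlonglongrightarrow> 0"
      by (rule tendsto_null_sum)
    then show "(\<lambda>i. measure M (sym_diff (S ` ?E i) (?E i))) \<longlonglongrightarrow> 0"
    proof (rule Lim_null_comparison[rotated])
      show "\<forall>\<^sub>F i in sequentially. norm (measure M (sym_diff (S ` ?E i) (?E i)))
          \<le> (\<Sum>j\<in>{1..k}. measure M (sym_diff (S ` ?C i j) (?C i j)))"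
        using assms(5) measure_sym_diff_image_INT_le[OF S', of "{1..k}"] C
        by (intro always_eventually allI) simp
    qed
  qed
qed

end
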